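(* Let $\Lambda$ be a $k$-graph and let $C$ be a connected component of the category $\mathbf{RG}(\Lambda)$ of representation $k$-graphs for $\Lambda$. Then, up to isomorphism, $(\Gamma_C,\xi_C)$ is the unique irreducible representation $k$-graph in $C$.
   Context: **$k$-graphs.** $\mathbb N=\{0,1,2,\dots\}$; for a positive integer $k$ the additive monoid $\mathbb N^k$ is viewed as a category with one object. A $k$-graph is a small category $\Lambda$ (the symbol $\Lambda$ also denotes its set of morphisms, $\Lambda^{\mathrm{ob}}$ its set of objects or vertices, $r,s$ the range and source maps) together with a functor $d:\Lambda\to\mathbb N^k$ (degree map) such that: if $d(\lambda)=m+n$ with $m,n\in\mathbb N^k$, there are unique $\mu,\nu\in\Lambda$ with $d(\mu)=m$, $d(\nu)=n$, $\lambda=\mu\circ\nu$. For $u,v\in\Lambda^{\mathrm{ob}}$, $n\in\mathbb N^k$: $u\Lambda=r^{-1}(u)$, $\Lambda v=s^{-1}(v)$, $u\Lambda v=u\Lambda\cap\Lambda v$, $u\Lambda^n=u\Lambda\cap d^{-1}(n)$. A morphism of $k$-graphs is a degree-preserving functor. Standing assumption: all $k$-graphs are nonempty ($\Lambda^{\mathrm{ob}}\ne\emptyset$), connected (the equivalence relation on $\Lambda^{\mathrm{ob}}$ generated by $\{(u,v): u\Lambda v\neq\emptyset\}$ is all of $\Lambda^{\mathrm{ob}}\times\Lambda^{\mathrm{ob}}$), row-finite (each $v\Lambda^n$ is finite) and without sources (each $v\Lambda^n$ is nonempty). **Walks.** Let $E_d$ be the directed graph with vertex set $\Lambda^{\mathrm{ob}}$,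 with one edge from $s(\lambda)$ to $r(\lambda)$ for each morphism $\lambda$ (identities included) and, for each non-identity $\lambda$, an extra edge $\lambda^*$ from $r(\lambda)$ to $s(\lambda)$. A walk in $\Lambda$ is a nonempty finite path $p=e_n\cdots e_1$ in $E_d$ ($s(e_i)=r(e_{i-1})$), with $s(p)=s(e_1)$, $r(p)=r(e_n)$. $\mathrm{Walk}_u(\Lambda)$ denotes the set of walks starting in $u$. A $k$-graph morphism $\alpha$ induces a map on walks (with $\lambda^*\mapsto\alpha(\lambda)^*$), again denoted $\alpha$. **Representation $k$-graphs.** A representation $k$-graph for $\Lambda$ is a pair $(\Delta,\alpha)$ of a $k$-graph $\Delta$ and a $k$-graph morphism $\alpha:\Delta\to\Lambda$ such that for every $v\in\Delta^{\mathrm{ob}}$: (i) $\alpha$ maps $\Delta v$ bijectively onto $\Lambda\alpha(v)$; (ii) $v\Delta^n$ is a singleton for every $n\in\mathbb N^k$. A morphism $(\Delta,\alpha)\to(\Sigma,\beta)$ is a $k$-graph morphism $\phi:\Delta\to\Sigma$ with $\beta\circ\phi=\alpha$. This gives the category $\mathbf{RG}(\Lambda)$. The connected components of a category are the full subcategories on the classes of objects for the equivalence relation generated by existence of a morphism. $(\Delta,\alpha)$ is irreducible if $\alpha(\mathrm{Walk}_u(\Delta))\neq\alpha(\mathrm{Walk}_v(\Delta))$ for all $u\neq v$ in $\Delta^{\mathrm{ob}}$. **The quotient by $\sim$.** For $(\Delta,\alpha)$ in $\mathbf{RG}(\Lambda)$ write $u\sim v$ (for $u,v\in\Delta^{\mathrm{ob}}$)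 if $\alpha(\mathrm{Walk}_u(\Delta))=\alpha(\mathrm{Walk}_v(\Delta))$. Put $\delta\sim\delta'$ for morphisms of $\Delta$ if $s(\delta)\sim s(\delta')$ and $\alpha(\delta)=\alpha(\delta')$. The quotient $(\Delta_\sim,\alpha_\sim)$ is the representation $k$-graph with objects $\Delta^{\mathrm{ob}}/{\sim}$, morphisms $\Delta/{\sim}$, $s([\delta])=[s(\delta)]$, $r([\delta])=[r(\delta)]$, $d([\delta])=d(\delta)$, $1_{[v]}=[1_v]$, composition $[\delta]\circ[\delta']=[\delta''\circ\delta']$ where $\delta''\in\Delta r(\delta')$ satisfies $\alpha(\delta'')=\alpha(\delta)$, and $\alpha_\sim([v])=\alpha(v)$, $\alpha_\sim([\delta])=\alpha(\delta)$. **Coverings.** A covering of a $k$-graph $\Delta$ is a pair $(\Omega,\tau)$ of a $k$-graph $\Omega$ and a $k$-graph morphism $\tau:\Omega\to\Delta$ such that for every $v\in\Omega^{\mathrm{ob}}$, $\tau$ maps $\Omega v$ bijectively onto $\Delta\tau(v)$ and $v\Omega$ bijectively onto $\tau(v)\Delta$. A morphism of coverings $(\Omega,\tau)\to(\Sigma,\beta)$ is a $k$-graph morphism $\phi:\Omega\to\Sigma$ with $\beta\circ\phi=\tau$. A covering is universal if it admits a morphism to every covering; every $k$-graph has a universal covering. **The objects $(\Omega_C,\zeta_C)$ and $(\Gamma_C,\xi_C)$.** Choose an object $(\Delta,\alpha)$ of $C$ and a universal covering $(\Omega,\tau)$ of $\Delta$; set $(\Omega_C,\zeta_C):=(\Omega,\alpha\circ\tau)$,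 which is an object of $C$, and $(\Gamma_C,\xi_C):=((\Omega_C)_\sim,(\zeta_C)_\sim)$. *)

theory Defs
  imports
    "HOL-Analysis.Finite_Cartesian_Product"
    "Graph_Theory.Arc_Walk"
begin

section \<open>Higher-rank graphs\<close>

text \<open>
  The rank is the cardinality of the finite (nonempty) type \<^typ>\<open>'k\<close>, and degrees live in the
  additive monoid \<open>nat ^ 'k\<close>.  Objects and morphisms form explicit carrier sets;
  the operations are only meaningful on these carriers, and \<open>Cmp G f g\<close> (first \<open>g\<close>, then \<open>f\<close>)
  only if \<open>Src G f = Rng G g\<close>.
\<close>

record ('o, 'm, 'k) kgraph_data =
  Obj :: "'o set"
  Mor :: "'m set"
  Src :: "'m \<Rightarrow> 'o"
  Rng :: "'m \<Rightarrow> 'o"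
  Idn :: "'o \<Rightarrow> 'm"
  Cmp :: "'m \<Rightarrow> 'm \<Rightarrow> 'm"
  Deg :: "'m \<Rightarrow> nat ^ 'k"

definition mor_from :: "('o, 'm, 'k::finite) kgraph_data \<Rightarrow> 'o \<Rightarrow> 'm set" where
  "mor_from G v = {f \<in> Mor G. Src G f = v}"

definition mor_to :: "('o, 'm, 'k::finite) kgraph_data \<Rightarrow> 'o \<Rightarrow> 'm set" where
  "mor_to G u = {f \<in> Mor G. Rng G f = u}"

definition mor_to_deg :: "('o, 'm, 'k::finite) kgraph_data \<Rightarrow> 'o \<Rightarrow> nat ^ 'k \<Rightarrow> 'm set" where
  "mor_to_deg G u n = {f \<in> mor_to G u. Deg G f = n}"

locale small_category =
  fixes G :: "('o, 'm, 'k::finite) kgraph_data"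
  assumes Src_in: "f \<in> Mor G \<Longrightarrow> Src G f \<in> Obj G"
    and Rng_in: "f \<in> Mor G \<Longrightarrow> Rng G f \<in> Obj G"
    and Idn_in: "v \<in> Obj G \<Longrightarrow> Idn G v \<in> Mor G"
    and Src_Idn: "v \<in> Obj G \<Longrightarrow> Src G (Idn G v) = v"
    and Rng_Idn: "v \<in> Obj G \<Longrightarrow> Rng G (Idn G v) = v"
    and Cmp_in: "\<lbrakk>f \<in> Mor G; g \<in> Mor G; Src G f = Rng G g\<rbrakk> \<Longrightarrow> Cmp G f g \<in> Mor G"
    and Src_Cmp: "\<lbrakk>f \<in> Mor G; g \<in> Mor G; Src G f = Rng G g\<rbrakk> \<Longrightarrow> Src G (Cmp G f g) = Src G g"
    and Rng_Cmp: "\<lbrakk>f \<in> Mor G; g \<in> Mor G; Src G f = Rng G g\<rbrakk> \<Longrightarrow> Rng G (Cmp G f g) = Rng G f"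
    and Cmp_assoc: "\<lbrakk>f \<in> Mor G; g \<in> Mor G; h \<in> Mor G; Src G f = Rng G g; Src G g = Rng G h\<rbrakk>
        \<Longrightarrow> Cmp G (Cmp G f g) h = Cmp G f (Cmp G g h)"
    and Cmp_Idn_left: "f \<in> Mor G \<Longrightarrow> Cmp G (Idn G (Rng G f)) f = f"
    and Cmp_Idn_right: "f \<in> Mor G \<Longrightarrow> Cmp G f (Idn G (Src G f)) = f"

text \<open>
  The locale \<open>kgraph\<close> includes the standing assumptions: nonempty, connected, row-finite and
  without sources.
\<close>

locale kgraph = small_category G
  for G :: "('o, 'm, 'k::finite) kgraph_data" +
  assumes Deg_Idn: "v \<in> Obj G \<Longrightarrow> Deg G (Idn G v) = 0"
    and Deg_Cmp: "\<lbrakk>f \<in> Mor G; g \<in> Mor G; Src G f = Rng G g\<rbrakk>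
        \<Longrightarrow> Deg G (Cmp G f g) = Deg G f + Deg G g"
    and factorization: "\<lbrakk>l \<in> Mor G; Deg G l = m + n\<rbrakk>
        \<Longrightarrow> \<exists>!(f, g). f \<in> Mor G \<and> g \<in> Mor G \<and> Src G f = Rng G g \<and>
              Deg G f = m \<and> Deg G g = n \<and> l = Cmp G f g"
    and nonempty: "Obj G \<noteq> {}"
    and connected: "\<lbrakk>u \<in> Obj G; v \<in> Obj G\<rbrakk>
        \<Longrightarrow> equivclp (\<lambda>x y. x \<in> Obj G \<and> y \<in> Obj G \<and> mor_to G x \<inter> mor_from G y \<noteq> {}) u v"
    and row_finite: "v \<in> Obj G \<Longrightarrow> finite (mor_to_deg G v n)"
    and no_sources: "v \<in> Obj G \<Longrightarrow> mor_to_deg G v n \<noteq> {}"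

subsection \<open>Morphisms\<close>

text \<open>
  A functor is given by its action on objects and on morphisms.  Values outside the carriers are
  irrelevant, so equality of functors is taken on the carriers of their domain.
\<close>

record ('o, 'm, 'p, 'q) fctr =
  omap :: "'o \<Rightarrow> 'p"
  mmap :: "'m \<Rightarrow> 'q"

definition kgraph_hom ::
  "('o, 'm, 'k::finite) kgraph_data \<Rightarrow> ('p, 'q, 'k) kgraph_data \<Rightarrow> ('o, 'm, 'p, 'q) fctr \<Rightarrow> bool" where
  "kgraph_hom G H F \<longleftrightarrow>
     (\<forall>v\<in>Obj G. omap F v \<in> Obj H \<and> mmap F (Idn G v) = Idn H (omap F v)) \<and>
     (\<forall>f\<in>Mor G. mmap F f \<in> Mor H \<and> Src H (mmap F f) = omap F (Src G f) \<and>
        Rng H (mmap F f) = omap F (Rng G f) \<and> Deg H (mmap F f) = Deg G f) \<and>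
     (\<forall>f\<in>Mor G. \<forall>g\<in>Mor G. Src G f = Rng G g \<longrightarrow>
        mmap F (Cmp G f g) = Cmp H (mmap F f) (mmap F g))"

definition functor_comp :: "('p, 'q, 'r, 's) fctr \<Rightarrow> ('o, 'm, 'p, 'q) fctr \<Rightarrow> ('o, 'm, 'r, 's) fctr" where
  "functor_comp F E = \<lparr>omap = omap F \<circ> omap E, mmap = mmap F \<circ> mmap E\<rparr>"

definition fid :: "('o, 'm, 'o, 'm) fctr" where
  "fid = \<lparr>omap = (\<lambda>v. v), mmap = (\<lambda>f. f)\<rparr>"

definition feq ::
  "('o, 'm, 'k::finite) kgraph_data \<Rightarrow> ('o, 'm, 'p, 'q) fctr \<Rightarrow> ('o, 'm, 'p, 'q) fctr \<Rightarrow> bool" where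
  "feq G E F \<longleftrightarrow> (\<forall>v\<in>Obj G. omap E v = omap F v) \<and> (\<forall>f\<in>Mor G. mmap E f = mmap F f)"

text \<open>
  Morphisms over a fixed base, used both for representation \<open>k\<close>-graphs and for coverings.
\<close>

definition over_hom ::
  "('o, 'm, 'k::finite) kgraph_data \<times> ('o, 'm, 'b, 'c) fctr \<Rightarrow>
   ('p, 'q, 'k) kgraph_data \<times> ('p, 'q, 'b, 'c) fctr \<Rightarrow> ('o, 'm, 'p, 'q) fctr \<Rightarrow> bool" where
  "over_hom X Y \<phi> \<longleftrightarrow> kgraph_hom (fst X) (fst Y) \<phi> \<and> feq (fst X) (functor_comp (snd Y) \<phi>) (snd X)"

definition over_iso ::
  "('o, 'm, 'k::finite) kgraph_data \<times> ('o, 'm, 'b, 'c) fctr \<Rightarrow>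
   ('p, 'q, 'k) kgraph_data \<times> ('p, 'q, 'b, 'c) fctr \<Rightarrow> bool" where
  "over_iso X Y \<longleftrightarrow> (\<exists>\<phi> \<psi>. over_hom X Y \<phi> \<and> over_hom Y X \<psi> \<and>
     feq (fst X) (functor_comp \<psi> \<phi>) fid \<and> feq (fst Y) (functor_comp \<phi> \<psi>) fid)"

subsection \<open>Walks\<close>

text \<open>\<open>Arr f\<close> is the edge \<open>f\<close> and \<open>Star f\<close> the edge \<open>f\<^sup>*\<close> of the digraph of walk steps.\<close>

datatype 'm step = Arr 'm | Star 'm

definition step_graph :: "('o, 'm, 'k::finite) kgraph_data \<Rightarrow> ('o, 'm step) pre_digraph" where
  "step_graph G =
     \<lparr>verts = Obj G,
      arcs = Arr ` Mor G \<union> Star ` (Mor G - Idn G ` Obj G),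
      tail = (\<lambda>e. case e of Arr f \<Rightarrow> Src G f | Star f \<Rightarrow> Rng G f),
      head = (\<lambda>e. case e of Arr f \<Rightarrow> Rng G f | Star f \<Rightarrow> Src G f)\<rparr>"

text \<open>A walk \<open>e\<^sub>n \<dots> e\<^sub>1\<close> is the list \<open>[e\<^sub>1, \<dots>, e\<^sub>n]\<close>, in order of traversal.\<close>

definition Walks_from :: "('o, 'm, 'k::finite) kgraph_data \<Rightarrow> 'o \<Rightarrow> 'm step list set" where
  "Walks_from G u = {p. p \<noteq> [] \<and> (\<exists>v. pre_digraph.awalk (step_graph G) u p v)}"

definition walk_map :: "('o, 'm, 'p, 'q) fctr \<Rightarrow> 'm step list \<Rightarrow> 'q step list" where
  "walk_map F = map (map_step (mmap F))"

section \<open>Representation \<open>k\<close>-graphs\<close>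

definition rep_kgraph ::
  "('o, 'm, 'k::finite) kgraph_data \<Rightarrow> ('p, 'q, 'k) kgraph_data \<times> ('p, 'q, 'o, 'm) fctr \<Rightarrow> bool" where
  "rep_kgraph L X \<longleftrightarrow> (case X of (D, \<alpha>) \<Rightarrow>
     kgraph D \<and> kgraph_hom D L \<alpha> \<and>
     (\<forall>v\<in>Obj D. bij_betw (mmap \<alpha>) (mor_from D v) (mor_from L (omap \<alpha> v)) \<and>
        (\<forall>n. is_singleton (mor_to_deg D v n))))"

text \<open>
  The objects of the category \<open>RG(L)\<close>, for \<open>k\<close>-graphs whose objects and morphisms are taken from a
  universe type \<^typ>\<open>'u\<close>.  Connected components are represented by their classes of objects.
\<close>

definition RG ::
  "('o, 'm, 'k::finite) kgraph_data \<Rightarrow> (('u, 'u, 'k) kgraph_data \<times> ('u, 'u, 'o, 'm) fctr) set" where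
  "RG L = {X. rep_kgraph L X}"

definition RG_components ::
  "('o, 'm, 'k::finite) kgraph_data \<Rightarrow> (('u, 'u, 'k) kgraph_data \<times> ('u, 'u, 'o, 'm) fctr) set set" where
  "RG_components L =
     RG L // {(X, Y). equivclp (\<lambda>X Y. X \<in> RG L \<and> Y \<in> RG L \<and> (\<exists>\<phi>. over_hom X Y \<phi>)) X Y}"

definition walk_equiv ::
  "('p, 'q, 'k::finite) kgraph_data \<times> ('p, 'q, 'o, 'm) fctr \<Rightarrow> ('p \<times> 'p) set" where
  "walk_equiv X = (case X of (D, \<alpha>) \<Rightarrow>
     {(u, v). u \<in> Obj D \<and> v \<in> Obj D \<and> walk_map \<alpha> ` Walks_from D u = walk_map \<alpha> ` Walks_from D v})"

definition irreducible_rep ::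
  "('p, 'q, 'k::finite) kgraph_data \<times> ('p, 'q, 'o, 'm) fctr \<Rightarrow> bool" where
  "irreducible_rep X \<longleftrightarrow> (case X of (D, \<alpha>) \<Rightarrow>
     \<forall>u\<in>Obj D. \<forall>v\<in>Obj D. u \<noteq> v \<longrightarrow>
       walk_map \<alpha> ` Walks_from D u \<noteq> walk_map \<alpha> ` Walks_from D v)"

subsection \<open>The quotient by walk equivalence\<close>

definition walk_equiv_mor ::
  "('p, 'q, 'k::finite) kgraph_data \<times> ('p, 'q, 'o, 'm) fctr \<Rightarrow> ('q \<times> 'q) set" where
  "walk_equiv_mor X = (case X of (D, \<alpha>) \<Rightarrow>
     {(f, g). f \<in> Mor D \<and> g \<in> Mor D \<and> (Src D f, Src D g) \<in> walk_equiv X \<and> mmap \<alpha> f = mmap \<alpha> g})"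

text \<open>
  Operations on classes are defined on representatives; \<^const>\<open>the_elem\<close> picks the common value.
\<close>

definition quotient_rep ::
  "('p, 'q, 'k::finite) kgraph_data \<times> ('p, 'q, 'o, 'm) fctr \<Rightarrow>
   ('p set, 'q set, 'k) kgraph_data \<times> ('p set, 'q set, 'o, 'm) fctr" where
  "quotient_rep X = (case X of (D, \<alpha>) \<Rightarrow>
     (\<lparr>Obj = Obj D // walk_equiv X,
       Mor = Mor D // walk_equiv_mor X,
       Src = (\<lambda>A. the_elem ((\<lambda>f. walk_equiv X `` {Src D f}) ` A)),
       Rng = (\<lambda>A. the_elem ((\<lambda>f. walk_equiv X `` {Rng D f}) ` A)),
       Idn = (\<lambda>V. the_elem ((\<lambda>v. walk_equiv_mor X `` {Idn D v}) ` V)),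
       Cmp = (\<lambda>A B. the_elem {walk_equiv_mor X `` {Cmp D h g} | f g h.
          f \<in> A \<and> g \<in> B \<and> h \<in> mor_from D (Rng D g) \<and> mmap \<alpha> h = mmap \<alpha> f}),
       Deg = (\<lambda>A. the_elem (Deg D ` A))\<rparr>,
      \<lparr>omap = (\<lambda>V. the_elem (omap \<alpha> ` V)),
       mmap = (\<lambda>A. the_elem (mmap \<alpha> ` A))\<rparr>))"

section \<open>Coverings\<close>

definition covering ::
  "('o, 'm, 'k::finite) kgraph_data \<Rightarrow> ('p, 'q, 'k) kgraph_data \<times> ('p, 'q, 'o, 'm) fctr \<Rightarrow> bool" where
  "covering D X \<longleftrightarrow> (case X of (W, \<tau>) \<Rightarrow>
     kgraph W \<and> kgraph_hom W D \<tau> \<and>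
     (\<forall>v\<in>Obj W. bij_betw (mmap \<tau>) (mor_from W v) (mor_from D (omap \<tau> v)) \<and>
        bij_betw (mmap \<tau>) (mor_to W v) (mor_to D (omap \<tau> v))))"

text \<open>
  The test coverings range over the universe type \<^typ>\<open>'u\<close>.  If the base has its objects and
  morphisms in \<^typ>\<open>'u\<close> as well, this is no restriction up to isomorphism: a covering is connected,
  so its morphisms are determined by a morphism of the base and a walk in the base from a
  fixed vertex.  There are at most as many such pairs as morphisms of the base, since that number
  is infinite.
\<close>

definition universal_covering ::
  "('u, 'u, 'k::finite) kgraph_data \<Rightarrow> ('u, 'u, 'k) kgraph_data \<times> ('u, 'u, 'u, 'u) fctr \<Rightarrow> bool" where
  "universal_covering D X \<longleftrightarrow> covering D X \<and>
     (\<forall>Y :: ('u, 'u, 'k) kgraph_data \<times> ('u, 'u, 'u, 'u) fctr.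
        covering D Y \<longrightarrow> (\<exists>\<phi>. over_hom X Y \<phi>))"

end

theory Submission
  imports Defs
begin

text \<open>
  A morphism of representation \<open>k\<close>-graphs is automatically a covering: sources lift because both
  labellings are bijective on morphisms with a fixed source, and ranges lift because there is
  exactly one morphism of each degree into a vertex.  Hence it preserves the labelled walks starting
  at a vertex and, by connectedness, is surjective on vertices.  So the family of all
  sets \<open>\<alpha>(Walk\<^sub>u(\<Delta>))\<close> is the same for all objects of a component of \<open>RG(\<Lambda>)\<close>, and an irreducible
  representation can be reconstructed from this family.
\<close>

section \<open>Traces of walks\<close>

text \<open>A representation behaves like a deterministic automaton: vertices are states, the edges
  \<open>Arr a\<close> and \<open>Star a\<close> of the base are letters. The letter
  \<open>Arr a\<close> leads from a vertex to at most one other, because labels are injective on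
  morphisms with a given source; so does \<open>Star a\<close>, because the label \<open>a\<close>
  fixes a degree and only one morphism of that degree ends in the vertex. If every state accepts,
  the labelled walks from a vertex form the language of that state, and the quotient by walk
  equivalence is Myhill-Nerode minimization. What needs care is that the minimized automaton is
  again a representation: a class must receive exactly one morphism of each degree, which is settled
  by reading starred letters. A second obstacle is typing. Vertices of the quotient are sets over
  \<open>'u\<close>, whereas objects of the category live on \<open>'u\<close> itself, so the
  quotient can only be isomorphic to a member of the component. An isomorphic copy on
  \<open>'u\<close> is therefore built explicitly.\<close>

lemma (in small_category) wf_step_graph: "wf_digraph (step_graph G)"
  by unfold_locales (auto simp: step_graph_def Src_in Rng_in)

text \<open>An identity can be split off on either side of \<open>f\<close>. If \<open>f\<close> has
  degree 0, both are factorizations for 0 = 0 + 0, so uniqueness identifies their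
  components.\<close>

lemma (in kgraph) Deg_0_Idn:
  assumes "f \<in> Mor G" "Deg G f = 0"
  shows "f = Idn G (Src G f)"
proof -
  have "\<exists>!(a, b). a \<in> Mor G \<and> b \<in> Mor G \<and> Src G a = Rng G b \<and>
      Deg G a = 0 \<and> Deg G b = 0 \<and> f = Cmp G a b" (is "Ex1 ?P")
    using factorization[of f 0 0] assms by simp
  moreover have "?P (f, Idn G (Src G f))" "?P (Idn G (Rng G f), f)"
    using assms by (simp_all add: Src_in Rng_in Idn_in Src_Idn Rng_Idn Deg_Idn Cmp_Idn_left
        Cmp_Idn_right)
  ultimately have "(f, Idn G (Src G f)) = (Idn G (Rng G f), f)" by blast
  then show ?thesis by simp
qed

fun readable ::
  "('p, 'q, 'k::finite) kgraph_data \<times> ('p, 'q, 'o, 'm) fctr \<Rightarrow> 'p \<Rightarrow> 'm step list \<Rightarrow> bool" where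
  "readable X u [] \<longleftrightarrow> True"
| "readable X u (Arr a # p) \<longleftrightarrow>
     (\<exists>f\<in>Mor (fst X). Src (fst X) f = u \<and> mmap (snd X) f = a \<and> readable X (Rng (fst X) f) p)"
| "readable X u (Star a # p) \<longleftrightarrow>
     (\<exists>f\<in>Mor (fst X) - Idn (fst X) ` Obj (fst X).
        Rng (fst X) f = u \<and> mmap (snd X) f = a \<and> readable X (Src (fst X) f) p)"

definition traces ::
  "('p, 'q, 'k::finite) kgraph_data \<times> ('p, 'q, 'o, 'm) fctr \<Rightarrow> 'p \<Rightarrow> 'm step list set" where
  "traces X u = {p. readable X u p}"

text \<open>The bridge to the walks of the digraph library. Peeling off the first edge is the
  recursion of \<open>readable\<close>.\<close>

lemma (in small_category) readable_iff_awalk: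
  "u \<in> Obj G \<Longrightarrow>
     readable (G, \<alpha>) u p \<longleftrightarrow> (\<exists>q v. pre_digraph.awalk (step_graph G) u q v \<and> walk_map \<alpha> q = p)"
proof (induction p arbitrary: u)
  case Nil
  interpret wf_digraph "step_graph G" by (rule wf_step_graph)
  have "u \<in> verts (step_graph G)" using Nil by (simp add: step_graph_def)
  then have "awalk u [] u" by (simp add: awalk_Nil_iff)
  then have "\<exists>q v. awalk u q v \<and> walk_map \<alpha> q = []" by (auto simp: walk_map_def)
  then show ?case by simp
next
  case (Cons a p)
  interpret wf_digraph "step_graph G" by (rule wf_step_graph)
  have *: "(\<exists>q v. awalk u q v \<and> walk_map \<alpha> q = a # p) \<longleftrightarrow>
    (\<exists>e\<in>arcs (step_graph G). tail (step_graph G) e = u \<and> map_step (mmap \<alpha>) e = a \<and>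
       (\<exists>q v. awalk (head (step_graph G) e) q v \<and> walk_map \<alpha> q = p))"
    (is "?l \<longleftrightarrow> ?r")
  proof
    assume ?l
    then obtain q v where q: "awalk u q v" "walk_map \<alpha> q = a # p" by blast
    then obtain e q' where "q = e # q'" "map_step (mmap \<alpha>) e = a" "walk_map \<alpha> q' = p"
      by (auto simp: walk_map_def map_eq_Cons_conv)
    then show ?r using q by (auto simp: awalk_Cons_iff)
  next
    assume ?r
    then obtain e q v where "e \<in> arcs (step_graph G)" "tail (step_graph G) e = u"
      "map_step (mmap \<alpha>) e = a" "awalk (head (step_graph G) e) q v" "walk_map \<alpha> q = p" by blast
    then have "awalk u (e # q) v \<and> walk_map \<alpha> (e # q) = a # p"
      by (auto simp: awalk_Cons_iff walk_map_def)
    then show ?l by blast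
  qed
  have "readable (G, \<alpha>) u (a # p) \<longleftrightarrow>
    (\<exists>e\<in>arcs (step_graph G). tail (step_graph G) e = u \<and> map_step (mmap \<alpha>) e = a \<and>
       readable (G, \<alpha>) (head (step_graph G) e) p)"
    by (cases a) (auto simp: step_graph_def bex_Un)
  also have "\<dots> \<longleftrightarrow> (\<exists>e\<in>arcs (step_graph G). tail (step_graph G) e = u \<and> map_step (mmap \<alpha>) e = a \<and>
       (\<exists>q v. awalk (head (step_graph G) e) q v \<and> walk_map \<alpha> q = p))"
  proof -
    have "head (step_graph G) e \<in> Obj G" if "e \<in> arcs (step_graph G)" for e
      using head_in_verts[OF that] by (simp add: step_graph_def)
    then show ?thesis using Cons.IH by blast
  qed
  finally show ?case using * by simp
qed

lemma (in small_category) image_Walks_from: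
  assumes "u \<in> Obj G"
  shows "walk_map \<alpha> ` Walks_from G u = traces (G, \<alpha>) u - {[]}"
proof -
  have "p \<in> walk_map \<alpha> ` Walks_from G u \<longleftrightarrow> p \<noteq> [] \<and> readable (G, \<alpha>) u p" for p
    unfolding readable_iff_awalk[OF assms] by (auto simp: Walks_from_def image_iff walk_map_def)
  then show ?thesis by (auto simp: traces_def)
qed

lemma Nil_in_traces: "[] \<in> traces X u"
  by (simp add: traces_def)

text \<open>The two descriptions differ only by the empty word, which every vertex accepts, so
  removing it on both sides loses no information.\<close>

lemma image_Walks_from_eq_iff:
  assumes "small_category D" "small_category E" "u \<in> Obj D" "v \<in> Obj E"
  shows "walk_map \<alpha> ` Walks_from D u = walk_map \<beta> ` Walks_from E v \<longleftrightarrow>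
    traces (D, \<alpha>) u = traces (E, \<beta>) v"
  unfolding small_category.image_Walks_from[OF assms(1,3)]
    small_category.image_Walks_from[OF assms(2,4)]
  using Nil_in_traces[of "(D, \<alpha>)" u] Nil_in_traces[of "(E, \<beta>)" v] by (metis insert_Diff)

lemma irreducible_rep_iff:
  assumes "small_category D"
  shows "irreducible_rep (D, \<alpha>) \<longleftrightarrow> inj_on (traces (D, \<alpha>)) (Obj D)"
  by (auto simp: irreducible_rep_def inj_on_def image_Walks_from_eq_iff[OF assms assms])

lemma mem_walk_equiv_iff:
  assumes "small_category D"
  shows "(u, v) \<in> walk_equiv (D, \<alpha>) \<longleftrightarrow>
    u \<in> Obj D \<and> v \<in> Obj D \<and> traces (D, \<alpha>) u = traces (D, \<alpha>) v"
  by (simp add: walk_equiv_def image_Walks_from_eq_iff[OF assms assms] cong: conj_cong)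

section \<open>Representations\<close>

locale rep_graph = kgraph D
  for D :: "('p, 'q, 'k::finite) kgraph_data" +
  fixes L :: "('o, 'm, 'k) kgraph_data" and \<alpha> :: "('p, 'q, 'o, 'm) fctr"
  assumes hom: "kgraph_hom D L \<alpha>"
    and bij_from: "v \<in> Obj D \<Longrightarrow> bij_betw (mmap \<alpha>) (mor_from D v) (mor_from L (omap \<alpha> v))"
    and singleton_to: "v \<in> Obj D \<Longrightarrow> is_singleton (mor_to_deg D v n)"

lemma rep_kgraph_iff: "rep_kgraph L (D, \<alpha>) \<longleftrightarrow> rep_graph D L \<alpha>"
  by (auto simp: rep_kgraph_def rep_graph_def rep_graph_axioms_def)

context rep_graph
begin

lemma label_Idn: "v \<in> Obj D \<Longrightarrow> mmap \<alpha> (Idn D v) = Idn L (omap \<alpha> v)"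
  and label_in: "f \<in> Mor D \<Longrightarrow> mmap \<alpha> f \<in> Mor L"
  and Src_label: "f \<in> Mor D \<Longrightarrow> Src L (mmap \<alpha> f) = omap \<alpha> (Src D f)"
  and Rng_label: "f \<in> Mor D \<Longrightarrow> Rng L (mmap \<alpha> f) = omap \<alpha> (Rng D f)"
  and Deg_label: "f \<in> Mor D \<Longrightarrow> Deg L (mmap \<alpha> f) = Deg D f"
  and label_Cmp: "f \<in> Mor D \<Longrightarrow> g \<in> Mor D \<Longrightarrow> Src D f = Rng D g \<Longrightarrow>
    mmap \<alpha> (Cmp D f g) = Cmp L (mmap \<alpha> f) (mmap \<alpha> g)"
  and omap_in: "v \<in> Obj D \<Longrightarrow> omap \<alpha> v \<in> Obj L"
  using hom by (auto simp: kgraph_hom_def)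

lemma eq_if_label_eq:
  assumes "f \<in> Mor D" "g \<in> Mor D" "Src D f = Src D g" "mmap \<alpha> f = mmap \<alpha> g"
  shows "f = g"
  using bij_from[OF Src_in[OF assms(1)]] assms
  by (auto simp: bij_betw_def inj_on_def mor_from_def)

lemma lift_from:
  assumes "v \<in> Obj D" "a \<in> Mor L" "Src L a = omap \<alpha> v"
  obtains f where "f \<in> Mor D" "Src D f = v" "mmap \<alpha> f = a"
proof -
  have "a \<in> mmap \<alpha> ` mor_from D v"
    using bij_from[OF assms(1)] assms by (auto simp: bij_betw_def mor_from_def)
  then show thesis using that by (auto simp: mor_from_def)
qed

lemma eq_if_Deg_eq:
  assumes "f \<in> Mor D" "g \<in> Mor D" "Rng D f = Rng D g" "Deg D f = Deg D g"
  shows "f = g"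
proof -
  obtain h where "mor_to_deg D (Rng D f) (Deg D f) = {h}"
    using singleton_to[OF Rng_in[OF assms(1)]] by (auto simp: is_singleton_def)
  moreover have "f \<in> mor_to_deg D (Rng D f) (Deg D f)" "g \<in> mor_to_deg D (Rng D f) (Deg D f)"
    using assms by (auto simp: mor_to_deg_def mor_to_def)
  ultimately show ?thesis by auto
qed

lemma ex_to:
  assumes "v \<in> Obj D"
  obtains f where "f \<in> Mor D" "Rng D f = v" "Deg D f = n"
  using no_sources[OF assms, of n] by (auto simp: mor_to_deg_def mor_to_def)

lemma readable_Arr_label:
  "f \<in> Mor D \<Longrightarrow>
     readable (D, \<alpha>) (Src D f) (Arr (mmap \<alpha> f) # p) \<longleftrightarrow> readable (D, \<alpha>) (Rng D f) p"
proof -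
  assume f: "f \<in> Mor D"
  have "g = f" if "g \<in> Mor D" "Src D g = Src D f" "mmap \<alpha> g = mmap \<alpha> f" for g
    using that f by (intro eq_if_label_eq)
  then show ?thesis using f by auto
qed

text \<open>Determinism for starred letters: equal labels have equal degrees, and a range together
  with a degree determines a morphism.\<close>

lemma readable_Star_label:
  "f \<in> Mor D - Idn D ` Obj D \<Longrightarrow>
     readable (D, \<alpha>) (Rng D f) (Star (mmap \<alpha> f) # p) \<longleftrightarrow> readable (D, \<alpha>) (Src D f) p"
proof -
  assume f: "f \<in> Mor D - Idn D ` Obj D"
  have "g = f" if "g \<in> Mor D" "Rng D g = Rng D f" "mmap \<alpha> g = mmap \<alpha> f" for g
  proof (rule eq_if_Deg_eq)
    show "Deg D g = Deg D f" using that f Deg_label[of f] Deg_label[of g] by simp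
  qed (use that f in auto)
  then show ?thesis using f by auto
qed

end

text \<open>The label of a vertex is visible in its traces: the identity at \<open>u\<close> gives a
  one-letter word, and the source of that letter in \<open>L\<close> is the label.\<close>

lemma omap_eq_if_traces_eq:
  assumes X: "rep_graph D L \<alpha>" and Y: "rep_graph E L \<beta>"
    and u: "u \<in> Obj D" and v: "v \<in> Obj E" and eq: "traces (D, \<alpha>) u = traces (E, \<beta>) v"
  shows "omap \<alpha> u = omap \<beta> v"
proof -
  interpret X: rep_graph D L \<alpha> by (rule X)
  interpret Y: rep_graph E L \<beta> by (rule Y)
  have "[Arr (mmap \<alpha> (Idn D u))] \<in> traces (D, \<alpha>) u"
    using u by (auto simp: traces_def X.Idn_in X.Src_Idn intro!: bexI[of _ "Idn D u"])
  then obtain g where "g \<in> Mor E" "Src E g = v" "mmap \<beta> g = mmap \<alpha> (Idn D u)"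
    unfolding eq by (auto simp: traces_def)
  then show ?thesis using X.Src_label[OF X.Idn_in[OF u]] Y.Src_label[of g] u by (simp add: X.Src_Idn)
qed

text \<open>By determinism the language at the range of \<open>f\<close> consists of the words that
  can follow the letter \<open>Arr (mmap \<alpha> f)\<close> in the language at its source.\<close>

lemma traces_Rng_eq:
  assumes X: "rep_graph D L \<alpha>" and Y: "rep_graph E L \<beta>"
    and "f \<in> Mor D" "g \<in> Mor E" "mmap \<alpha> f = mmap \<beta> g"
    and eq: "traces (D, \<alpha>) (Src D f) = traces (E, \<beta>) (Src E g)"
  shows "traces (D, \<alpha>) (Rng D f) = traces (E, \<beta>) (Rng E g)"
proof -
  have "readable (D, \<alpha>) (Src D f) p = readable (E, \<beta>) (Src E g) p" for p
    using eq by (auto simp: traces_def)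
  from this[of "Arr (mmap \<alpha> f) # _"] show ?thesis
    using rep_graph.readable_Arr_label[OF X assms(3)]
      rep_graph.readable_Arr_label[OF Y assms(4)] assms(5)
    by (simp add: traces_def del: readable.simps)
qed

text \<open>This is where the edges \<open>f\<^sup>*\<close> enter.  Identities have no such edge, hence the case of
  degree \<open>0\<close>.\<close>

lemma (in rep_graph) traces_Src_eq:
  assumes f: "f \<in> Mor D" and g: "g \<in> Mor D" and deg: "Deg D f = Deg D g"
    and eq: "traces (D, \<alpha>) (Rng D f) = traces (D, \<alpha>) (Rng D g)"
  shows "mmap \<alpha> f = mmap \<alpha> g \<and> traces (D, \<alpha>) (Src D f) = traces (D, \<alpha>) (Src D g)"
proof (cases "Deg D f = 0")
  case True
  \<comment> \<open>For identities the hypothesis on ranges already speaks of sources, and the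
    labels are the identities at equal vertices of \<open>L\<close>.\<close>
  then have "f = Idn D (Src D f)" "g = Idn D (Src D g)"
    using Deg_0_Idn f g deg by auto
  then have R: "Rng D f = Src D f" "Rng D g = Src D g"
    "mmap \<alpha> f = Idn L (omap \<alpha> (Src D f))" "mmap \<alpha> g = Idn L (omap \<alpha> (Src D g))"
    using f g by (metis Rng_Idn Src_in label_Idn)+
  then show ?thesis
    using eq omap_eq_if_traces_eq[OF rep_graph_axioms rep_graph_axioms] f g
    by (metis Src_in)
next
  case False
  have nid: "h \<in> Mor D - Idn D ` Obj D" if "h \<in> Mor D" "Deg D h = Deg D f" for h
    using that False Deg_Idn by auto
  have *: "readable (D, \<alpha>) (Rng D f) p = readable (D, \<alpha>) (Rng D g) p" for p
    using eq by (auto simp: traces_def)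
  \<comment> \<open>The starred letter of \<open>f\<close> can be read at the range of
    \<open>f\<close>, hence at that of \<open>g\<close>. The morphism read there has the degree and
    the range of \<open>g\<close>, so it is \<open>g\<close>, which therefore carries the label of
    \<open>f\<close>.\<close>
  have "readable (D, \<alpha>) (Rng D g) [Star (mmap \<alpha> f)]"
    unfolding *[symmetric] using readable_Star_label[OF nid[OF f refl], of "[]"] by simp
  then obtain h where h: "h \<in> Mor D" "Rng D h = Rng D g" "mmap \<alpha> h = mmap \<alpha> f" by auto
  then have "h = g" using eq_if_Deg_eq g deg f Deg_label by metis
  then have lab: "mmap \<alpha> f = mmap \<alpha> g" using h by simp
  then show ?thesis
    using *[of "Star (mmap \<alpha> f) # _"] readable_Star_label[OF nid[OF f refl]]
      readable_Star_label[OF nid[OF g deg[symmetric]]]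
    by (simp add: traces_def del: readable.simps)
qed

section \<open>Morphisms of representations are coverings\<close>

locale rep_hom = X: rep_graph D L \<alpha> + Y: rep_graph E L \<beta>
  for D :: "('p, 'q, 'k::finite) kgraph_data"
    and L :: "('o, 'm, 'k) kgraph_data" and \<alpha> :: "('p, 'q, 'o, 'm) fctr"
    and E :: "('r, 's, 'k) kgraph_data" and \<beta> :: "('r, 's, 'o, 'm) fctr" +
  fixes \<phi> :: "('p, 'q, 'r, 's) fctr"
  assumes over: "over_hom (D, \<alpha>) (E, \<beta>) \<phi>"
begin

lemma omap_in: "v \<in> Obj D \<Longrightarrow> omap \<phi> v \<in> Obj E"
  and mmap_Idn: "v \<in> Obj D \<Longrightarrow> mmap \<phi> (Idn D v) = Idn E (omap \<phi> v)"
  and mmap_in: "f \<in> Mor D \<Longrightarrow> mmap \<phi> f \<in> Mor E"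
  and Src_mmap: "f \<in> Mor D \<Longrightarrow> Src E (mmap \<phi> f) = omap \<phi> (Src D f)"
  and Rng_mmap: "f \<in> Mor D \<Longrightarrow> Rng E (mmap \<phi> f) = omap \<phi> (Rng D f)"
  and Deg_mmap: "f \<in> Mor D \<Longrightarrow> Deg E (mmap \<phi> f) = Deg D f"
  and over_omap: "v \<in> Obj D \<Longrightarrow> omap \<beta> (omap \<phi> v) = omap \<alpha> v"
  and over_mmap: "f \<in> Mor D \<Longrightarrow> mmap \<beta> (mmap \<phi> f) = mmap \<alpha> f"
  using over by (auto simp: over_hom_def kgraph_hom_def feq_def functor_comp_def)

lemma lift_Src:
  assumes "u \<in> Obj D" "g \<in> Mor E" "Src E g = omap \<phi> u"
  obtains f where "f \<in> Mor D" "Src D f = u" "mmap \<phi> f = g"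
proof -
  obtain f where f: "f \<in> Mor D" "Src D f = u" "mmap \<alpha> f = mmap \<beta> g"
    using X.lift_from[of u "mmap \<beta> g"] assms by (auto simp: Y.label_in Y.Src_label over_omap)
  then have "mmap \<phi> f = g"
    using Y.eq_if_label_eq[of "mmap \<phi> f" g] assms by (simp add: mmap_in Src_mmap over_mmap)
  then show thesis using f that by blast
qed

text \<open>Labels play no part in the choice of the lift: the morphism into \<open>u\<close> of the
  degree of \<open>g\<close> is mapped to one with the range and degree of \<open>g\<close>, which
  can only be \<open>g\<close>.\<close>

lemma lift_Rng:
  assumes "u \<in> Obj D" "g \<in> Mor E" "Rng E g = omap \<phi> u"
  obtains f where "f \<in> Mor D" "Rng D f = u" "mmap \<phi> f = g"
proof -
  obtain f where f: "f \<in> Mor D" "Rng D f = u" "Deg D f = Deg E g"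
    using X.ex_to[OF assms(1)] by blast
  then have "mmap \<phi> f = g"
    using Y.eq_if_Deg_eq[of "mmap \<phi> f" g] assms by (simp add: mmap_in Rng_mmap Deg_mmap)
  then show thesis using f that by blast
qed

text \<open>Only non-identities have starred edges, so lifting these edges requires that identities
  be reflected. The degree detects them.\<close>

lemma mmap_eq_Idn_iff:
  assumes "f \<in> Mor D"
  shows "mmap \<phi> f \<in> Idn E ` Obj E \<longleftrightarrow> f \<in> Idn D ` Obj D"
proof
  assume "mmap \<phi> f \<in> Idn E ` Obj E"
  then have "Deg D f = 0" using Deg_mmap[OF assms] Y.Deg_Idn by auto
  then show "f \<in> Idn D ` Obj D" using X.Deg_0_Idn[OF assms] X.Src_in[OF assms] by blast
qed (auto simp: mmap_Idn omap_in)

lemma readable_omap: "u \<in> Obj D \<Longrightarrow> readable (E, \<beta>) (omap \<phi> u) p \<longleftrightarrow> readable (D, \<alpha>) u p"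
proof (induction p arbitrary: u)
  case (Cons a p)
  show ?case
  proof (cases a)
    case (Arr b)
    have "readable (E, \<beta>) (omap \<phi> u) (Arr b # p) \<longleftrightarrow>
      (\<exists>f\<in>Mor D. Src D f = u \<and> mmap \<beta> (mmap \<phi> f) = b \<and> readable (E, \<beta>) (Rng E (mmap \<phi> f)) p)"
      (is "_ \<longleftrightarrow> ?r")
    proof
      assume "readable (E, \<beta>) (omap \<phi> u) (Arr b # p)"
      then obtain g where g: "g \<in> Mor E" "Src E g = omap \<phi> u"
        "mmap \<beta> g = b" "readable (E, \<beta>) (Rng E g) p" by auto
      obtain f where "f \<in> Mor D" "Src D f = u" "mmap \<phi> f = g"
        using lift_Src[OF Cons.prems g(1,2)] .
      then show ?r using g by blast
    next
      assume ?r
      then obtain f where f: "f \<in> Mor D" "Src D f = u"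
        "mmap \<beta> (mmap \<phi> f) = b" "readable (E, \<beta>) (Rng E (mmap \<phi> f)) p" by blast
      then show "readable (E, \<beta>) (omap \<phi> u) (Arr b # p)"
        using mmap_in[of f] Src_mmap[of f] by auto
    qed
    then show ?thesis using Arr Cons.IH by (auto simp: over_mmap Rng_mmap X.Rng_in)
  next
    case (Star b)
    have "readable (E, \<beta>) (omap \<phi> u) (Star b # p) \<longleftrightarrow>
      (\<exists>f\<in>Mor D - Idn D ` Obj D.
         Rng D f = u \<and> mmap \<beta> (mmap \<phi> f) = b \<and> readable (E, \<beta>) (Src E (mmap \<phi> f)) p)"
      (is "_ \<longleftrightarrow> ?r")
    proof
      assume "readable (E, \<beta>) (omap \<phi> u) (Star b # p)"
      then obtain g where g: "g \<in> Mor E" "g \<notin> Idn E ` Obj E" "Rng E g = omap \<phi> u"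
        "mmap \<beta> g = b" "readable (E, \<beta>) (Src E g) p" by auto
      obtain f where "f \<in> Mor D" "Rng D f = u" "mmap \<phi> f = g"
        using lift_Rng[OF Cons.prems g(1,3)] .
      then show ?r using g mmap_eq_Idn_iff by blast
    next
      assume ?r
      then obtain f where f: "f \<in> Mor D" "f \<notin> Idn D ` Obj D" "Rng D f = u"
        "mmap \<beta> (mmap \<phi> f) = b" "readable (E, \<beta>) (Src E (mmap \<phi> f)) p" by blast
      then show "readable (E, \<beta>) (omap \<phi> u) (Star b # p)"
        using mmap_in[of f] mmap_eq_Idn_iff[of f] Rng_mmap[of f] by auto
    qed
    then show ?thesis using Star Cons.IH by (auto simp: over_mmap Src_mmap X.Src_in)
  qed
qed simp

lemma traces_omap: "u \<in> Obj D \<Longrightarrow> traces (E, \<beta>) (omap \<phi> u) = traces (D, \<alpha>) u"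
  by (simp add: traces_def readable_omap)

lemma omap_surj: "omap \<phi> ` Obj D = Obj E"
proof
  show "Obj E \<subseteq> omap \<phi> ` Obj D"
  proof
    fix y assume y: "y \<in> Obj E"
    obtain x where x: "x \<in> Obj D" using X.nonempty by blast
    from Y.connected[OF omap_in[OF x] y] show "y \<in> omap \<phi> ` Obj D"
    proof (induction rule: equivclp_induct)
      case base
      then show ?case using x by blast
    next
      case (step y z)
      then obtain u where u: "u \<in> Obj D" "y = omap \<phi> u" by blast
      \<comment> \<open>A link of the connecting chain may be traversed in either direction; each
        direction has its own lifting lemma, so the image is closed under both.\<close>
      from step(2) show ?case
      proof
        assume "y \<in> Obj E \<and> z \<in> Obj E \<and> mor_to E y \<inter> mor_from E z \<noteq> {}"
        then obtain g where g: "g \<in> Mor E" "Rng E g = omap \<phi> u" "Src E g = z"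
          using u by (auto simp: mor_to_def mor_from_def)
        obtain f where "f \<in> Mor D" "mmap \<phi> f = g" using lift_Rng[OF u(1) g(1,2)] .
        then show ?thesis using g Src_mmap[of f] X.Src_in[of f] by auto
      next
        assume "z \<in> Obj E \<and> y \<in> Obj E \<and> mor_to E z \<inter> mor_from E y \<noteq> {}"
        then obtain g where g: "g \<in> Mor E" "Src E g = omap \<phi> u" "Rng E g = z"
          using u by (auto simp: mor_to_def mor_from_def)
        obtain f where "f \<in> Mor D" "mmap \<phi> f = g" using lift_Src[OF u(1) g(1,2)] .
        then show ?thesis using g Rng_mmap[of f] X.Rng_in[of f] by auto
      qed
    qed
  qed
qed (auto simp: omap_in)

lemma traces_image_eq: "traces (E, \<beta>) ` Obj E = traces (D, \<alpha>) ` Obj D"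
  unfolding omap_surj[symmetric] image_image by (simp add: traces_omap)

end

section \<open>Irreducible representations are determined by their traces\<close>

text \<open>A vertex goes to the vertex of \<open>E\<close> with the same traces, a morphism to the
  lift of its label starting there. Injectivity on the target forces the lift to end at the right
  vertex.\<close>

lemma ex_over_hom:
  assumes X: "rep_graph D L \<alpha>" and Y: "rep_graph E L \<beta>"
    and sub: "traces (D, \<alpha>) ` Obj D \<subseteq> traces (E, \<beta>) ` Obj E"
    and inj: "inj_on (traces (E, \<beta>)) (Obj E)"
  shows "\<exists>\<phi>. over_hom (D, \<alpha>) (E, \<beta>) \<phi>"
proof -
  interpret X: rep_graph D L \<alpha> by (rule X)
  interpret Y: rep_graph E L \<beta> by (rule Y)
  have "\<forall>u\<in>Obj D. \<exists>v\<in>Obj E. traces (E, \<beta>) v = traces (D, \<alpha>) u"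
    using sub by (metis image_iff image_subset_iff)
  then obtain po where po: "\<And>u. u \<in> Obj D \<Longrightarrow> po u \<in> Obj E"
    "\<And>u. u \<in> Obj D \<Longrightarrow> traces (E, \<beta>) (po u) = traces (D, \<alpha>) u" by metis
  have lab: "omap \<beta> (po u) = omap \<alpha> u" if "u \<in> Obj D" for u
    using omap_eq_if_traces_eq[OF Y X] po that by blast
  have "\<forall>f\<in>Mor D. \<exists>g\<in>Mor E. Src E g = po (Src D f) \<and> mmap \<beta> g = mmap \<alpha> f"
    using Y.lift_from[OF po(1)] X.label_in X.Src_label X.Src_in lab by metis
  then obtain pm where pm: "\<And>f. f \<in> Mor D \<Longrightarrow> pm f \<in> Mor E"
    "\<And>f. f \<in> Mor D \<Longrightarrow> Src E (pm f) = po (Src D f)"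
    "\<And>f. f \<in> Mor D \<Longrightarrow> mmap \<beta> (pm f) = mmap \<alpha> f" by metis
  \<comment> \<open>Both vertices have the traces of \<open>Rng D f\<close>: the first since traces
    propagate along equal labels, the second by the choice of \<open>po\<close>.\<close>
  have rng: "Rng E (pm f) = po (Rng D f)" if f: "f \<in> Mor D" for f
  proof -
    have "traces (E, \<beta>) (Rng E (pm f)) = traces (D, \<alpha>) (Rng D f)"
      using traces_Rng_eq[OF Y X] pm po X.Src_in f by metis
    then show ?thesis
      using inj pm po X.Rng_in Y.Rng_in f by (metis inj_onD)
  qed
  have "over_hom (D, \<alpha>) (E, \<beta>) \<lparr>omap = po, mmap = pm\<rparr>"
    unfolding over_hom_def kgraph_hom_def feq_def functor_comp_def
  \<comment> \<open>For identities and composites, both sides have the same source and the same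
    label in \<open>E\<close>, hence agree; degrees are read off from labels.\<close>
  proof (simp add: po pm rng lab, intro conjI ballI impI)
    fix v assume v: "v \<in> Obj D"
    show "pm (Idn D v) = Idn E (po v)"
      using v by (intro Y.eq_if_label_eq)
        (simp_all add: X.Idn_in pm po Y.Idn_in Y.Src_Idn X.Src_Idn X.label_Idn Y.label_Idn lab)
  next
    fix f assume "f \<in> Mor D"
    then show "Deg E (pm f) = Deg D f" using pm X.Deg_label Y.Deg_label by metis
  next
    fix f g assume "f \<in> Mor D" "g \<in> Mor D" "Src D f = Rng D g"
    then show "pm (Cmp D f g) = Cmp E (pm f) (pm g)"
      by (intro Y.eq_if_label_eq)
        (simp_all add: X.Cmp_in pm rng Y.Cmp_in X.Src_Cmp Y.Src_Cmp X.label_Cmp Y.label_Cmp)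
  qed
  then show ?thesis by blast
qed

text \<open>Rigidity: a morphism preserves traces, so here it fixes every vertex, and then every
  morphism by its source and label. It makes morphisms in opposite directions between irreducible
  representations mutually inverse.\<close>

lemma over_hom_endo_id:
  assumes X: "rep_graph D L \<alpha>" and inj: "inj_on (traces (D, \<alpha>)) (Obj D)"
    and "over_hom (D, \<alpha>) (D, \<alpha>) \<phi>"
  shows "feq D \<phi> fid"
proof -
  interpret rep_hom D L \<alpha> D \<alpha> \<phi>
    using assms by (simp add: rep_hom_def rep_hom_axioms_def)
  have o: "omap \<phi> v = v" if "v \<in> Obj D" for v
    using inj that traces_omap omap_in by (metis inj_onD)
  moreover have "mmap \<phi> f = f" if "f \<in> Mor D" for f
    using that o X.Src_in[OF that]
    by (intro X.eq_if_label_eq) (simp_all add: mmap_in Src_mmap over_mmap)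
  ultimately show ?thesis by (simp add: feq_def fid_def)
qed

lemma over_hom_comp:
  assumes "over_hom X Y \<phi>" "over_hom Y Z \<psi>"
  shows "over_hom X Z (functor_comp \<psi> \<phi>)"
  using assms by (simp add: over_hom_def kgraph_hom_def feq_def functor_comp_def)

lemma over_iso_if_traces_eq:
  assumes X: "rep_graph D L \<alpha>" and Y: "rep_graph E L \<beta>"
    and eq: "traces (D, \<alpha>) ` Obj D = traces (E, \<beta>) ` Obj E"
    and injX: "inj_on (traces (D, \<alpha>)) (Obj D)" and injY: "inj_on (traces (E, \<beta>)) (Obj E)"
  shows "over_iso (D, \<alpha>) (E, \<beta>)"
proof -
  obtain \<phi> where \<phi>: "over_hom (D, \<alpha>) (E, \<beta>) \<phi>" using ex_over_hom[OF X Y _ injY] eq by blast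
  obtain \<psi> where \<psi>: "over_hom (E, \<beta>) (D, \<alpha>) \<psi>" using ex_over_hom[OF Y X _ injX] eq by blast
  show ?thesis
    unfolding over_iso_def
    using \<phi> \<psi> over_hom_endo_id[OF X injX over_hom_comp[OF \<phi> \<psi>]]
      over_hom_endo_id[OF Y injY over_hom_comp[OF \<psi> \<phi>]] by auto
qed

section \<open>Images of representations\<close>

text \<open>Common frame for the quotient and for a copy on another type: the data of
  \<open>H\<close> are transported along \<open>po\<close> and \<open>pm\<close>, and
  \<open>H\<close> is then shown to be a representation. The last two assumptions give
  \<open>H\<close> the two uniqueness properties, for a given source and label and for a given range
  and degree.\<close>

locale rep_image = rep_graph D L \<alpha>
  for D :: "('p, 'q, 'k::finite) kgraph_data"
    and L :: "('o, 'm, 'k) kgraph_data" and \<alpha> :: "('p, 'q, 'o, 'm) fctr" +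
  fixes H :: "('r, 's, 'k) kgraph_data" and \<beta> :: "('r, 's, 'o, 'm) fctr"
    and po :: "'p \<Rightarrow> 'r" and pm :: "'q \<Rightarrow> 's"
  assumes Obj_H: "Obj H = po ` Obj D" and Mor_H: "Mor H = pm ` Mor D"
    and Src_H: "f \<in> Mor D \<Longrightarrow> Src H (pm f) = po (Src D f)"
    and Rng_H: "f \<in> Mor D \<Longrightarrow> Rng H (pm f) = po (Rng D f)"
    and Deg_H: "f \<in> Mor D \<Longrightarrow> Deg H (pm f) = Deg D f"
    and Idn_H: "v \<in> Obj D \<Longrightarrow> Idn H (po v) = pm (Idn D v)"
    and Cmp_H: "f \<in> Mor D \<Longrightarrow> g \<in> Mor D \<Longrightarrow> Src D f = Rng D g \<Longrightarrow>
      Cmp H (pm f) (pm g) = pm (Cmp D f g)"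
    and omap_H: "v \<in> Obj D \<Longrightarrow> omap \<beta> (po v) = omap \<alpha> v"
    and mmap_H: "f \<in> Mor D \<Longrightarrow> mmap \<beta> (pm f) = mmap \<alpha> f"
    and eq_if_Src: "f \<in> Mor D \<Longrightarrow> g \<in> Mor D \<Longrightarrow> po (Src D f) = po (Src D g) \<Longrightarrow>
      mmap \<alpha> f = mmap \<alpha> g \<Longrightarrow> pm f = pm g"
    and eq_if_Rng: "f \<in> Mor D \<Longrightarrow> g \<in> Mor D \<Longrightarrow> po (Rng D f) = po (Rng D g) \<Longrightarrow>
      Deg D f = Deg D g \<Longrightarrow> pm f = pm g"
begin

text \<open>Preimages of composable morphisms need not be composable, as their end vertices may
  agree only after applying \<open>po\<close>. This allows a preimage to be moved to a prescribed
  source by lifting its label there.\<close>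

lemma lift_mor:
  assumes "a \<in> Mor H" "v \<in> Obj D" "Src H a = po v"
  obtains f where "f \<in> Mor D" "Src D f = v" "a = pm f"
proof -
  obtain f' where f': "f' \<in> Mor D" "a = pm f'" using assms by (auto simp: Mor_H)
  then have "Src L (mmap \<alpha> f') = omap \<alpha> v"
    using assms by (metis Src_H Src_in Src_label omap_H)
  then obtain f where f: "f \<in> Mor D" "Src D f = v" "mmap \<alpha> f = mmap \<alpha> f'"
    using lift_from[of v "mmap \<alpha> f'"] assms f' by (auto simp: label_in)
  then have "pm f' = pm f" using f' assms by (intro eq_if_Src) (simp_all add: Src_H)
  then show thesis using f f' that by blast
qed

lemma lift_composable:
  assumes "a \<in> Mor H" "b \<in> Mor H" "Src H a = Rng H b"
  obtains f g where "f \<in> Mor D" "g \<in> Mor D" "Src D f = Rng D g" "a = pm f" "b = pm g"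
proof -
  obtain g where g: "g \<in> Mor D" "b = pm g" using assms by (auto simp: Mor_H)
  obtain f where "f \<in> Mor D" "Src D f = Rng D g" "a = pm f"
    using lift_mor[OF assms(1) Rng_in[OF g(1)]] assms g by (auto simp: Rng_H)
  then show thesis using g that by blast
qed

lemma small_category_image: "small_category H"
proof
  fix v assume "v \<in> Obj H"
  then show "Idn H v \<in> Mor H" "Src H (Idn H v) = v" "Rng H (Idn H v) = v"
    by (auto simp: Obj_H Mor_H Idn_H Idn_in Src_H Rng_H Src_Idn Rng_Idn)
next
  fix f assume "f \<in> Mor H"
  then obtain f' where "f' \<in> Mor D" "f = pm f'" by (auto simp: Mor_H)
  then show "Src H f \<in> Obj H" "Rng H f \<in> Obj H" "Cmp H (Idn H (Rng H f)) f = f"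
    "Cmp H f (Idn H (Src H f)) = f"
    by (simp_all add: Obj_H Src_H Rng_H Src_in Rng_in Idn_H Cmp_H Idn_in Src_Idn Rng_Idn
        Cmp_Idn_left Cmp_Idn_right)
next
  fix f g assume "f \<in> Mor H" "g \<in> Mor H" "Src H f = Rng H g"
  then obtain f' g' where "f' \<in> Mor D" "g' \<in> Mor D" "Src D f' = Rng D g'" "f = pm f'" "g = pm g'"
    by (rule lift_composable)
  then show "Cmp H f g \<in> Mor H" "Src H (Cmp H f g) = Src H g" "Rng H (Cmp H f g) = Rng H f"
    by (simp_all add: Mor_H Cmp_H Cmp_in Src_H Rng_H Src_Cmp Rng_Cmp)
next
  fix f g h assume fgh: "f \<in> Mor H" "g \<in> Mor H" "h \<in> Mor H" "Src H f = Rng H g" "Src H g = Rng H h"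
  obtain g' h' where g': "g' \<in> Mor D" "h' \<in> Mor D" "Src D g' = Rng D h'" "g = pm g'" "h = pm h'"
    using lift_composable[OF fgh(2,3,5)] .
  obtain f' where f': "f' \<in> Mor D" "Src D f' = Rng D g'" "f = pm f'"
    using lift_mor[OF fgh(1) Rng_in[OF g'(1)]] fgh g' by (auto simp: Rng_H)
  show "Cmp H (Cmp H f g) h = Cmp H f (Cmp H g h)"
    using g' f' by (simp add: Cmp_H Cmp_in Src_Cmp Rng_Cmp Cmp_assoc)
qed

lemma factorization_image:
  assumes "l \<in> Mor H" "Deg H l = m + n"
  shows "\<exists>!(f, g). f \<in> Mor H \<and> g \<in> Mor H \<and> Src H f = Rng H g \<and>
    Deg H f = m \<and> Deg H g = n \<and> l = Cmp H f g"
proof -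
  obtain l' where l': "l' \<in> Mor D" "l = pm l'" using assms by (auto simp: Mor_H)
  then have "Deg D l' = m + n" using assms by (simp add: Deg_H)
  from factorization[OF l'(1) this] obtain f g where fg:
    "f \<in> Mor D" "g \<in> Mor D" "Src D f = Rng D g" "Deg D f = m" "Deg D g = n" "l' = Cmp D f g"
    by (auto elim!: ex1E)
  show ?thesis
  proof (rule ex1I[of _ "(pm f, pm g)"])
    show "case (pm f, pm g) of (f, g) \<Rightarrow> f \<in> Mor H \<and> g \<in> Mor H \<and> Src H f = Rng H g \<and>
      Deg H f = m \<and> Deg H g = n \<and> l = Cmp H f g"
      using fg l' by (simp add: Mor_H Src_H Rng_H Deg_H Cmp_H)
  next
    fix x assume "case x of (f, g) \<Rightarrow> f \<in> Mor H \<and> g \<in> Mor H \<and> Src H f = Rng H g \<and>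
      Deg H f = m \<and> Deg H g = n \<and> l = Cmp H f g"
    then obtain a b where ab: "x = (a, b)" "a \<in> Mor H" "b \<in> Mor H" "Src H a = Rng H b"
      "Deg H a = m" "Deg H b = n" "l = Cmp H a b" by auto
    obtain f' g' where fg': "f' \<in> Mor D" "g' \<in> Mor D" "Src D f' = Rng D g'" "a = pm f'" "b = pm g'"
      using lift_composable[OF ab(2-4)] .
    \<comment> \<open>Comparing ranges identifies the left factors by their degree. Their common
      source is the range of both right factors, so the same argument applies to these.\<close>
    have "pm (Cmp D f' g') = pm (Cmp D f g)" using ab fg' fg l' by (simp add: Cmp_H)
    then have "po (Rng D f') = po (Rng D f)"
      using fg fg' by (metis Cmp_in Rng_Cmp Rng_H)
    then have f: "pm f' = pm f" using fg fg' ab by (intro eq_if_Rng) (simp_all add: Deg_H)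
    then have "po (Rng D g') = po (Rng D g)" using fg fg' by (metis Src_H)
    then have "pm g' = pm g" using fg fg' ab by (intro eq_if_Rng) (simp_all add: Deg_H)
    then show "x = (pm f, pm g)" using f ab fg' by simp
  qed
qed

lemma singleton_to_image:
  assumes "v \<in> Obj H"
  shows "is_singleton (mor_to_deg H v n)"
proof -
  obtain u where u: "u \<in> Obj D" "v = po u" using assms by (auto simp: Obj_H)
  obtain f where f: "f \<in> Mor D" "Rng D f = u" "Deg D f = n" using ex_to[OF u(1)] by blast
  show ?thesis
  proof (rule is_singletonI')
    have "pm f \<in> mor_to_deg H v n"
      using u f by (simp add: mor_to_deg_def mor_to_def Mor_H Rng_H Deg_H)
    then show "mor_to_deg H v n \<noteq> {}" by blast
  next
    fix a b assume "a \<in> mor_to_deg H v n" "b \<in> mor_to_deg H v n"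
    then obtain f g where "f \<in> Mor D" "a = pm f" "Rng H (pm f) = v" "Deg H (pm f) = n"
      "g \<in> Mor D" "b = pm g" "Rng H (pm g) = v" "Deg H (pm g) = n"
      by (auto simp: mor_to_deg_def mor_to_def Mor_H)
    then show "a = b" using eq_if_Rng[of f g] Rng_H[of f] Rng_H[of g] Deg_H[of f] Deg_H[of g] by argo
  qed
qed

lemma connected_image:
  assumes "u \<in> Obj H" "v \<in> Obj H"
  shows "equivclp (\<lambda>x y. x \<in> Obj H \<and> y \<in> Obj H \<and> mor_to H x \<inter> mor_from H y \<noteq> {}) u v"
    (is "equivclp ?R u v")
proof -
  obtain u' v' where uv: "u' \<in> Obj D" "u = po u'" "v' \<in> Obj D" "v = po v'"
    using assms by (auto simp: Obj_H)
  have R: "?R (po x) (po y)" if "x \<in> Obj D \<and> y \<in> Obj D \<and> mor_to D x \<inter> mor_from D y \<noteq> {}" for x y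
  proof -
    from that obtain f where "f \<in> Mor D" "Rng D f = x" "Src D f = y"
      by (auto simp: mor_to_def mor_from_def)
    then have "pm f \<in> mor_to H (po x) \<inter> mor_from H (po y)"
      by (auto simp: mor_to_def mor_from_def Mor_H Rng_H Src_H)
    then show ?thesis using that by (auto simp: Obj_H)
  qed
  from connected[OF uv(1,3)] have "equivclp ?R (po u') (po v')"
  proof (induction rule: equivclp_induct)
    case (step y z)
    then have "?R (po y) (po z) \<or> ?R (po z) (po y)" using R by blast
    then show ?case by (rule equivclp_into_equivclp[OF step.IH])
  qed simp
  then show ?thesis using uv by simp
qed

lemma kgraph_image: "kgraph H"
proof -
  interpret H: small_category H by (rule small_category_image)
  show ?thesis
  proof
    fix v assume "v \<in> Obj H"
    then show "Deg H (Idn H v) = 0" by (auto simp: Obj_H Idn_H Deg_H Idn_in Deg_Idn)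
  next
    fix f g assume "f \<in> Mor H" "g \<in> Mor H" "Src H f = Rng H g"
    then obtain f' g' where "f' \<in> Mor D" "g' \<in> Mor D" "Src D f' = Rng D g'" "f = pm f'" "g = pm g'"
      by (rule lift_composable)
    then show "Deg H (Cmp H f g) = Deg H f + Deg H g" by (simp add: Cmp_H Cmp_in Deg_H Deg_Cmp)
  next
    show "Obj H \<noteq> {}" using nonempty by (simp add: Obj_H)
  next
    fix v n assume "v \<in> Obj H"
    from singleton_to_image[OF this, of n] show "finite (mor_to_deg H v n)" "mor_to_deg H v n \<noteq> {}"
      by (auto elim: is_singletonE)
  qed (use factorization_image connected_image in auto)
qed

lemma representation_image: "rep_graph H L \<beta>"
proof -
  interpret H: kgraph H by (rule kgraph_image)
  show ?thesis
  proof
    show "kgraph_hom H L \<beta>"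
      unfolding kgraph_hom_def
    proof (intro conjI ballI impI)
      fix v assume "v \<in> Obj H"
      then show "omap \<beta> v \<in> Obj L" "mmap \<beta> (Idn H v) = Idn L (omap \<beta> v)"
        by (auto simp: Obj_H omap_H omap_in Idn_H mmap_H Idn_in label_Idn)
    next
      fix f assume "f \<in> Mor H"
      then show "mmap \<beta> f \<in> Mor L" "Src L (mmap \<beta> f) = omap \<beta> (Src H f)"
        "Rng L (mmap \<beta> f) = omap \<beta> (Rng H f)" "Deg L (mmap \<beta> f) = Deg H f"
        by (auto simp: Mor_H mmap_H label_in Src_H Rng_H Deg_H omap_H Src_in Rng_in Src_label
            Rng_label Deg_label)
    next
      fix f g assume "f \<in> Mor H" "g \<in> Mor H" "Src H f = Rng H g"
      then obtain f' g' where "f' \<in> Mor D" "g' \<in> Mor D" "Src D f' = Rng D g'" "f = pm f'" "g = pm g'"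
        by (rule lift_composable)
      then show "mmap \<beta> (Cmp H f g) = Cmp L (mmap \<beta> f) (mmap \<beta> g)"
        by (simp add: Cmp_H Cmp_in mmap_H label_Cmp)
    qed
  next
    fix v assume v: "v \<in> Obj H"
    then obtain u where u: "u \<in> Obj D" "v = po u" by (auto simp: Obj_H)
    have "mor_from H v = pm ` mor_from D u"
    proof
      show "mor_from H v \<subseteq> pm ` mor_from D u"
      proof
        fix a assume "a \<in> mor_from H v"
        then have "a \<in> Mor H" "Src H a = po u" using u by (simp_all add: mor_from_def)
        then obtain f where "f \<in> Mor D" "Src D f = u" "a = pm f" using lift_mor u(1) by metis
        then show "a \<in> pm ` mor_from D u" by (simp add: mor_from_def)
      qed
    qed (use u in \<open>auto simp: mor_from_def Mor_H Src_H\<close>)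
    moreover have "inj_on (mmap \<beta>) (mor_from H v)"
    proof (rule inj_onI)
      fix a b assume "a \<in> mor_from H v" "b \<in> mor_from H v" and ab: "mmap \<beta> a = mmap \<beta> b"
      then obtain f g where fg: "f \<in> Mor D" "a = pm f" "Src H (pm f) = v"
        "g \<in> Mor D" "b = pm g" "Src H (pm g) = v"
        by (auto simp: mor_from_def Mor_H)
      have "po (Src D f) = po (Src D g)" using fg Src_H by metis
      moreover have "mmap \<alpha> f = mmap \<alpha> g" using fg ab mmap_H by metis
      ultimately show "a = b" using eq_if_Src fg by metis
    qed
    moreover have "mmap \<beta> ` pm ` mor_from D u = mmap \<alpha> ` mor_from D u"
      by (auto simp: mor_from_def mmap_H image_iff)
    ultimately show "bij_betw (mmap \<beta>) (mor_from H v) (mor_from L (omap \<beta> v))"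
      using bij_from[OF u(1)] u by (simp add: bij_betw_def omap_H)
  qed (rule singleton_to_image)
qed

lemma over_hom_image: "over_hom (D, \<alpha>) (H, \<beta>) \<lparr>omap = po, mmap = pm\<rparr>"
  by (simp add: over_hom_def kgraph_hom_def feq_def functor_comp_def Obj_H Mor_H Src_H Rng_H Deg_H
      Idn_H Cmp_H omap_H mmap_H)

text \<open>The projection onto the image is itself a morphism of representations, so the invariance
  of traces applies.\<close>

lemma traces_image: "u \<in> Obj D \<Longrightarrow> traces (H, \<beta>) (po u) = traces (D, \<alpha>) u"
  using rep_hom.traces_omap[of D L \<alpha> H \<beta> "\<lparr>omap = po, mmap = pm\<rparr>"] over_hom_image
    representation_image rep_graph_axioms
  by (simp add: rep_hom_def rep_hom_axioms_def)

end

text \<open>Transport along injections of the carriers; it brings the quotient, whose elements are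
  classes, back to the type of the original representation.\<close>

lemma ex_copy:
  fixes H :: "('r, 's, 'k::finite) kgraph_data" and \<beta> :: "('r, 's, 'o, 'm) fctr"
    and a :: "'r \<Rightarrow> 'p" and b :: "'s \<Rightarrow> 'q"
  assumes "rep_graph H L \<beta>" "inj_on (traces (H, \<beta>)) (Obj H)"
    and a: "inj_on a (Obj H)" and b: "inj_on b (Mor H)"
  shows "\<exists>K \<gamma> \<phi>. rep_graph K L \<gamma> \<and> inj_on (traces (K, \<gamma>)) (Obj K) \<and>
    over_hom (H, \<beta>) (K, \<gamma> :: ('p, 'q, 'o, 'm) fctr) \<phi>"
proof -
  interpret H: rep_graph H L \<beta> by fact
  define a' b' where "a' = inv_into (Obj H) a" and "b' = inv_into (Mor H) b"
  have inv [simp]: "v \<in> Obj H \<Longrightarrow> a' (a v) = v" "f \<in> Mor H \<Longrightarrow> b' (b f) = f" for v f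
    using a b by (auto simp: a'_def b'_def)
  define K :: "('p, 'q, 'k) kgraph_data" where
    "K = \<lparr>Obj = a ` Obj H, Mor = b ` Mor H, Src = a \<circ> Src H \<circ> b', Rng = a \<circ> Rng H \<circ> b',
      Idn = b \<circ> Idn H \<circ> a', Cmp = (\<lambda>f g. b (Cmp H (b' f) (b' g))), Deg = Deg H \<circ> b'\<rparr>"
  define \<gamma> where "\<gamma> = \<lparr>omap = omap \<beta> \<circ> a', mmap = mmap \<beta> \<circ> b'\<rparr>"
  interpret rep_image H L \<beta> K \<gamma> a b
  proof
    fix f g assume fg: "f \<in> Mor H" "g \<in> Mor H"
    { assume "a (Src H f) = a (Src H g)" "mmap \<beta> f = mmap \<beta> g"
      then show "b f = b g" using fg H.eq_if_label_eq[OF fg] inj_onD[OF a] H.Src_in by metis }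
    { assume "a (Rng H f) = a (Rng H g)" "Deg H f = Deg H g"
      then show "b f = b g" using fg H.eq_if_Deg_eq[OF fg] inj_onD[OF a] H.Rng_in by metis }
  qed (simp_all add: K_def \<gamma>_def)
  have "inj_on (traces (K, \<gamma>)) (Obj K)"
    using assms(2) by (auto simp: inj_on_def Obj_H traces_image)
  then show ?thesis using representation_image over_hom_image by blast
qed

section \<open>The quotient by walk equivalence\<close>

lemma the_elem_image_eq:
  assumes "x \<in> A" "\<And>y. y \<in> A \<Longrightarrow> f y = f x"
  shows "the_elem (f ` A) = f x"
proof -
  have "f ` A = {f x}" using assms by blast
  then show ?thesis by simp
qed

context rep_graph
begin

abbreviation "vcls u \<equiv> walk_equiv (D, \<alpha>) `` {u}"
abbreviation "mcls f \<equiv> walk_equiv_mor (D, \<alpha>) `` {f}"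

lemma mem_walk_equiv: "(u, v) \<in> walk_equiv (D, \<alpha>) \<longleftrightarrow>
    u \<in> Obj D \<and> v \<in> Obj D \<and> traces (D, \<alpha>) u = traces (D, \<alpha>) v"
  by (rule mem_walk_equiv_iff) unfold_locales

lemma mem_walk_equiv_mor: "(f, g) \<in> walk_equiv_mor (D, \<alpha>) \<longleftrightarrow>
    f \<in> Mor D \<and> g \<in> Mor D \<and> traces (D, \<alpha>) (Src D f) = traces (D, \<alpha>) (Src D g) \<and> mmap \<alpha> f = mmap \<alpha> g"
  by (auto simp: walk_equiv_mor_def mem_walk_equiv Src_in)

lemma equiv_walk_equiv: "equiv (Obj D) (walk_equiv (D, \<alpha>))"
  by (auto intro!: equivI refl_onI symI transI simp: mem_walk_equiv)

lemma equiv_walk_equiv_mor: "equiv (Mor D) (walk_equiv_mor (D, \<alpha>))"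
  by (auto intro!: equivI refl_onI symI transI simp: mem_walk_equiv_mor)

lemma vcls_eq_iff: "u \<in> Obj D \<Longrightarrow> v \<in> Obj D \<Longrightarrow>
    vcls u = vcls v \<longleftrightarrow> traces (D, \<alpha>) u = traces (D, \<alpha>) v"
  by (simp add: eq_equiv_class_iff[OF equiv_walk_equiv] mem_walk_equiv)

lemma mcls_eq_iff: "f \<in> Mor D \<Longrightarrow> g \<in> Mor D \<Longrightarrow>
    mcls f = mcls g \<longleftrightarrow> traces (D, \<alpha>) (Src D f) = traces (D, \<alpha>) (Src D g) \<and> mmap \<alpha> f = mmap \<alpha> g"
  by (simp add: eq_equiv_class_iff[OF equiv_walk_equiv_mor] mem_walk_equiv_mor)

text \<open>The class of a composite depends only on the traces at the source of its right factor
  and on the label, which is the composite of the labels. All choices of representatives agree on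
  both; \<open>f\<close> itself serves as \<open>h\<close> to show that a choice exists.\<close>

lemma quotient_Cmp:
  assumes f: "f \<in> Mor D" and g: "g \<in> Mor D" and fg: "Src D f = Rng D g"
  shows "{mcls (Cmp D h g') | f' g' h. f' \<in> mcls f \<and> g' \<in> mcls g \<and>
      h \<in> mor_from D (Rng D g') \<and> mmap \<alpha> h = mmap \<alpha> f'} = {mcls (Cmp D f g)}"
    (is "?S = _")
proof -
  have "mcls (Cmp D f g) \<in> ?S"
    using assms by (force simp: mem_walk_equiv_mor mor_from_def)
  moreover have "x = mcls (Cmp D f g)" if "x \<in> ?S" for x
  proof -
    from that obtain f' g' h where x: "x = mcls (Cmp D h g')" "f' \<in> mcls f" "g' \<in> mcls g"
      "h \<in> mor_from D (Rng D g')" "mmap \<alpha> h = mmap \<alpha> f'" by blast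
    then show ?thesis
      using assms by (simp add: mcls_eq_iff mem_walk_equiv_mor mor_from_def Cmp_in Src_Cmp label_Cmp)
  qed
  ultimately show ?thesis by blast
qed

lemma rep_image_quotient:
  "rep_image D L \<alpha> (fst (quotient_rep (D, \<alpha>))) (snd (quotient_rep (D, \<alpha>))) vcls mcls"
proof
  show "Obj (fst (quotient_rep (D, \<alpha>))) = vcls ` Obj D"
    "Mor (fst (quotient_rep (D, \<alpha>))) = mcls ` Mor D"
    by (auto simp: quotient_rep_def quotient_def)
next
  fix f assume f: "f \<in> Mor D"
  then have mem: "f \<in> mcls f" by (simp add: mem_walk_equiv_mor)
  show "Src (fst (quotient_rep (D, \<alpha>))) (mcls f) = vcls (Src D f)"
    by (simp add: quotient_rep_def, rule the_elem_image_eq[OF mem])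
      (auto simp: mem_walk_equiv_mor vcls_eq_iff Src_in)
  show "Rng (fst (quotient_rep (D, \<alpha>))) (mcls f) = vcls (Rng D f)"
    by (simp add: quotient_rep_def, rule the_elem_image_eq[OF mem])
      (auto simp: mem_walk_equiv_mor vcls_eq_iff Rng_in
        traces_Rng_eq[OF rep_graph_axioms rep_graph_axioms])
  show "Deg (fst (quotient_rep (D, \<alpha>))) (mcls f) = Deg D f"
    by (simp add: quotient_rep_def, rule the_elem_image_eq[OF mem])
      (metis Deg_label Image_singleton_iff mem_walk_equiv_mor)
  show "mmap (snd (quotient_rep (D, \<alpha>))) (mcls f) = mmap \<alpha> f"
    by (simp add: quotient_rep_def, rule the_elem_image_eq[OF mem])
      (simp add: mem_walk_equiv_mor)
next
  fix v assume v: "v \<in> Obj D"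
  then have mem: "v \<in> vcls v" by (simp add: mem_walk_equiv)
  have lab: "omap \<alpha> u = omap \<alpha> v" if "u \<in> vcls v" for u
    using that omap_eq_if_traces_eq[OF rep_graph_axioms rep_graph_axioms]
    by (metis Image_singleton_iff mem_walk_equiv)
  have "mcls (Idn D u) = mcls (Idn D v)" if "u \<in> vcls v" for u
    using that lab[OF that] by (simp add: mem_walk_equiv mcls_eq_iff Idn_in Src_Idn label_Idn)
  then show "Idn (fst (quotient_rep (D, \<alpha>))) (vcls v) = mcls (Idn D v)"
    by (simp add: quotient_rep_def the_elem_image_eq[OF mem])
  show "omap (snd (quotient_rep (D, \<alpha>))) (vcls v) = omap \<alpha> v"
    by (simp add: quotient_rep_def, rule the_elem_image_eq[OF mem]) (rule lab)
next
  fix f g assume fg: "f \<in> Mor D" "g \<in> Mor D"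
  { assume "Src D f = Rng D g"
    then show "Cmp (fst (quotient_rep (D, \<alpha>))) (mcls f) (mcls g) = mcls (Cmp D f g)"
      unfolding quotient_rep_def using quotient_Cmp fg by simp }
  { assume "vcls (Src D f) = vcls (Src D g)" "mmap \<alpha> f = mmap \<alpha> g"
    then show "mcls f = mcls g" using fg by (simp add: vcls_eq_iff mcls_eq_iff Src_in) }
  \<comment> \<open>Uniqueness of the morphism of given degree into a class: equivalence passes
    backwards from ranges to sources, with equal labels.\<close>
  { assume "vcls (Rng D f) = vcls (Rng D g)" "Deg D f = Deg D g"
    then show "mcls f = mcls g"
      using traces_Src_eq[OF fg] by (simp add: vcls_eq_iff mcls_eq_iff Rng_in fg) }
qed

lemma inj_traces_quotient:
  "inj_on (traces (quotient_rep (D, \<alpha>))) (Obj (fst (quotient_rep (D, \<alpha>))))"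
proof -
  interpret Q: rep_image D L \<alpha> "fst (quotient_rep (D, \<alpha>))" "snd (quotient_rep (D, \<alpha>))" vcls mcls
    by (rule rep_image_quotient)
  show ?thesis
    using Q.traces_image by (auto simp: inj_on_def Q.Obj_H vcls_eq_iff)
qed

end

text \<open>Classes are nonempty and pairwise disjoint, so a chosen element determines its class.
  This encodes classes by elements of the original type.\<close>

lemma inj_on_some_elem:
  assumes "equiv A r"
  shows "inj_on (\<lambda>B. SOME x. x \<in> B) (A // r)"
proof (rule inj_onI)
  fix B B' assume B: "B \<in> A // r" "B' \<in> A // r" "(SOME x. x \<in> B) = (SOME x. x \<in> B')"
  then have "(SOME x. x \<in> B) \<in> B" "(SOME x. x \<in> B') \<in> B'"
    using in_quotient_imp_non_empty[OF assms] some_in_eq by blast+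
  then show "B = B'" using B quotient_disj[OF assms B(1,2)] by auto
qed

section \<open>Coverings and components\<close>

text \<open>Bijections on morphisms with a fixed source compose. Two morphisms of equal degree into
  one vertex have the same image in \<open>D\<close>, and a covering is injective on morphisms into
  a vertex; existence comes from the absence of sources in \<open>W\<close>.\<close>

lemma representation_covering:
  assumes "rep_graph D L \<alpha>" "covering D (W, \<tau>)"
  shows "rep_graph W L (functor_comp \<alpha> \<tau>)"
    and "over_hom (W, functor_comp \<alpha> \<tau>) (D, \<alpha>) \<tau>"
proof -
  interpret rep_graph D L \<alpha> by fact
  have hom_\<tau>: "kgraph_hom W D \<tau>" and "kgraph W" using assms(2) by (auto simp: covering_def)
  interpret W: kgraph W by fact
  show "over_hom (W, functor_comp \<alpha> \<tau>) (D, \<alpha>) \<tau>"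
    using hom_\<tau> by (simp add: over_hom_def feq_def)
  show "rep_graph W L (functor_comp \<alpha> \<tau>)"
  proof
    show "kgraph_hom W L (functor_comp \<alpha> \<tau>)"
      using hom_\<tau> hom by (simp add: kgraph_hom_def functor_comp_def)
  next
    fix v assume v: "v \<in> Obj W"
    then have \<tau>v: "omap \<tau> v \<in> Obj D" using hom_\<tau> by (simp add: kgraph_hom_def)
    have "bij_betw (mmap \<tau>) (mor_from W v) (mor_from D (omap \<tau> v))"
      using assms(2) v by (simp add: covering_def)
    from bij_betw_trans[OF this bij_from[OF \<tau>v]]
    show "bij_betw (mmap (functor_comp \<alpha> \<tau>)) (mor_from W v)
      (mor_from L (omap (functor_comp \<alpha> \<tau>) v))"
      by (simp add: functor_comp_def)
    fix n
    obtain f where f: "f \<in> mor_to_deg W v n" using W.no_sources[OF v] by blast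
    have inj: "inj_on (mmap \<tau>) (mor_to W v)"
      using assms(2) v by (simp add: covering_def bij_betw_def)
    have "g = f" if "g \<in> mor_to_deg W v n" for g
    proof -
      have "mmap \<tau> g = mmap \<tau> f"
        using that f hom_\<tau> by (intro eq_if_Deg_eq) (auto simp: kgraph_hom_def mor_to_deg_def mor_to_def)
      then show ?thesis using inj that f by (auto simp: inj_on_def mor_to_deg_def)
    qed
    then show "is_singleton (mor_to_deg W v n)" using f by (intro is_singletonI') auto
  qed
qed

lemma component_invariant:
  assumes "equivclp (\<lambda>X Y. X \<in> RG L \<and> Y \<in> RG L \<and> (\<exists>\<phi>. over_hom X Y \<phi>)) X Y" "X \<in> RG L"
  shows "Y \<in> RG L \<and> traces X ` Obj (fst X) = traces Y ` Obj (fst Y)"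
  using assms(1)
proof (induction rule: equivclp_induct)
  \<comment> \<open>The generated equivalence is reflexive on the whole type, so membership of the
    starting object has to be supplied separately.\<close>
  case base
  then show ?case using assms(2) by simp
next
  case (step Y Z)
  have hom: "traces Y ` Obj (fst Y) = traces Z ` Obj (fst Z)"
    if "Y \<in> RG L" "Z \<in> RG L" "over_hom Y Z \<phi>" for Y Z :: "('a, 'a, 'b) kgraph_data \<times> _" and \<phi>
  proof -
    obtain D \<alpha> E \<beta> where "Y = (D, \<alpha>)" "Z = (E, \<beta>)" by (cases Y, cases Z)
    then show ?thesis
      using that rep_hom.traces_image_eq[of D L \<alpha> E \<beta> \<phi>]
      by (simp add: RG_def rep_kgraph_iff rep_hom_def rep_hom_axioms_def)
  qed
  show ?case using step hom[of Y Z] hom[of Z Y] by metis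
qed

theorem corollary17:
  fixes \<Lambda> :: "('o, 'm, 'k::finite) kgraph_data"
    and C :: "(('u, 'u, 'k) kgraph_data \<times> ('u, 'u, 'o, 'm) fctr) set"
    and \<Delta> \<Omega> :: "('u, 'u, 'k) kgraph_data"
    and \<alpha> :: "('u, 'u, 'o, 'm) fctr"
    and \<tau> :: "('u, 'u, 'u, 'u) fctr"
  assumes "kgraph \<Lambda>"
    and "C \<in> RG_components \<Lambda>"
    and "(\<Delta>, \<alpha>) \<in> C"
    and "universal_covering \<Delta> (\<Omega>, \<tau>)"
  shows "rep_kgraph \<Lambda> (quotient_rep (\<Omega>, functor_comp \<alpha> \<tau>))
    \<and> irreducible_rep (quotient_rep (\<Omega>, functor_comp \<alpha> \<tau>))
    \<and> (\<exists>X\<in>C. over_iso X (quotient_rep (\<Omega>, functor_comp \<alpha> \<tau>)))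
    \<and> (\<forall>X\<in>C. irreducible_rep X \<longrightarrow> over_iso X (quotient_rep (\<Omega>, functor_comp \<alpha> \<tau>)))"
proof -
  let ?step = "\<lambda>X Y :: ('u, 'u, 'k) kgraph_data \<times> ('u, 'u, 'o, 'm) fctr.
    X \<in> RG \<Lambda> \<and> Y \<in> RG \<Lambda> \<and> (\<exists>\<phi>. over_hom X Y \<phi>)"
  let ?\<zeta> = "functor_comp \<alpha> \<tau>"
  obtain X0 where X0: "X0 \<in> RG \<Lambda>" and C: "C = {X. equivclp ?step X0 X}"
    using assms(2) by (auto simp: RG_components_def elim!: quotientE)
  have inv: "X \<in> RG \<Lambda> \<and> traces X0 ` Obj (fst X0) = traces X ` Obj (fst X)" if "X \<in> C" for X
    by (rule component_invariant[OF _ X0]) (use that C in simp)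
  then have inRG: "X \<in> RG \<Lambda>" if "X \<in> C" for X
    using that by blast
  have traces_eq: "traces X ` Obj (fst X) = traces Y ` Obj (fst Y)" if "X \<in> C" "Y \<in> C" for X Y
    using inv[OF that(1)] inv[OF that(2)] by simp
  have closed: "Y \<in> C" if "X \<in> C" "?step X Y \<or> ?step Y X" for X Y
    using that equivclp_into_equivclp[of ?step X0 X Y] by (auto simp: C)
  have "rep_graph \<Delta> \<Lambda> \<alpha>"
    using inRG[OF assms(3)] by (simp add: RG_def rep_kgraph_iff)
  moreover have "covering \<Delta> (\<Omega>, \<tau>)" using assms(4) by (simp add: universal_covering_def)
  ultimately have rep: "rep_graph \<Omega> \<Lambda> ?\<zeta>" and "over_hom (\<Omega>, ?\<zeta>) (\<Delta>, \<alpha>) \<tau>"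
    by (rule representation_covering)+
  \<comment> \<open>The covering map is a morphism to \<open>(\<Delta>, \<alpha>)\<close> over the
    base, which places its domain in the same component.\<close>
  then have \<Omega>C: "(\<Omega>, ?\<zeta>) \<in> C"
    using inRG[OF assms(3)] by (intro closed[OF assms(3)]) (auto simp: RG_def rep_kgraph_iff)
  obtain Q \<xi> where Q: "quotient_rep (\<Omega>, ?\<zeta>) = (Q, \<xi>)" by fastforce
  interpret R: rep_graph \<Omega> \<Lambda> ?\<zeta> by (rule rep)
  interpret Q: rep_image \<Omega> \<Lambda> ?\<zeta> Q \<xi> R.vcls R.mcls
    using R.rep_image_quotient by (simp add: Q)
  have repQ: "rep_graph Q \<Lambda> \<xi>" by (rule Q.representation_image)
  then have catQ: "small_category Q" by (simp add: rep_graph_def kgraph_def)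
  have injQ: "inj_on (traces (Q, \<xi>)) (Obj Q)" using R.inj_traces_quotient by (simp add: Q)
  have iso: "over_iso X (Q, \<xi>)" if "X \<in> C" "irreducible_rep X" for X
  proof -
    obtain D \<beta> where X: "X = (D, \<beta>)" by fastforce
    have repD: "rep_graph D \<Lambda> \<beta>" using inRG[OF that(1)] by (simp add: X RG_def rep_kgraph_iff)
    then have "inj_on (traces (D, \<beta>)) (Obj D)"
      using that(2) irreducible_rep_iff[of D \<beta>] by (simp add: X rep_graph_def kgraph_def)
    \<comment> \<open>The quotient has the wrong type to belong to \<open>C\<close>, so its traces
      are compared through \<open>\<Omega>\<close>, which does belong to \<open>C\<close>.\<close>
    moreover have "traces (D, \<beta>) ` Obj D = traces (Q, \<xi>) ` Obj Q"
      using traces_eq[OF that(1) \<Omega>C] by (auto simp: X Q.Obj_H Q.traces_image image_image)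
    ultimately show ?thesis unfolding X using over_iso_if_traces_eq[OF repD repQ] injQ by blast
  qed
  \<comment> \<open>Replacing each class by a chosen element yields a copy on \<open>'u\<close>. The
    composite from \<open>\<Omega>\<close> through the quotient to this copy puts it in
    \<open>C\<close>; being irreducible, it is isomorphic to the quotient by
    \<open>iso\<close>.\<close>
  have "inj_on (\<lambda>B. SOME x. x \<in> B) (Obj Q)" "inj_on (\<lambda>B. SOME x. x \<in> B) (Mor Q)"
    using inj_on_some_elem[OF R.equiv_walk_equiv] inj_on_some_elem[OF R.equiv_walk_equiv_mor]
    by (simp_all add: Q.Obj_H Q.Mor_H quotient_def UNION_singleton_eq_range)
  from ex_copy[OF repQ injQ this] obtain K \<gamma> \<phi> where K: "rep_graph K \<Lambda> \<gamma>"
    "inj_on (traces (K, \<gamma>)) (Obj K)" "over_hom (Q, \<xi>) (K, \<gamma> :: ('u, 'u, 'o, 'm) fctr) \<phi>" by blast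
  have "(K, \<gamma>) \<in> C"
    using over_hom_comp[OF Q.over_hom_image K(3)] rep K(1)
    by (intro closed[OF \<Omega>C]) (auto simp: RG_def rep_kgraph_iff)
  moreover have "irreducible_rep (K, \<gamma>)"
    using K irreducible_rep_iff[of K \<gamma>] by (simp add: rep_graph_def kgraph_def)
  ultimately have "\<exists>X\<in>C. over_iso X (Q, \<xi>)" using iso by blast
  moreover have "irreducible_rep (Q, \<xi>)" using injQ irreducible_rep_iff[OF catQ, of \<xi>] by simp
  ultimately show ?thesis using repQ iso by (simp add: Q rep_kgraph_iff)
qed

end
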